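(* Let $(A,\circ,[\cdot,\cdot])$ be a finite-dimensional GD algebra over $\Bbbk$. Then $A$ is nilpotent (as a GD algebra) if and only if the following three conditions hold: (1) the Lie algebra $(A,[\cdot,\cdot])$ is nilpotent; (2) the Novikov algebra $(A,\circ)$ is nilpotent; (3) the two-sided ideal $\mathcal I_{R\operatorname{ad}}$ of the multiplication algebra $\mathcal M(A)$ is nilpotent.
   Context: $\Bbbk$ is an algebraically closed field of characteristic $0$. A Novikov algebra is a vector space with a bilinear product $\circ$ satisfying $(x\circ y)\circ z-x\circ(y\circ z)=(y\circ x)\circ z-y\circ(x\circ z)$ and $(x\circ y)\circ z=(x\circ z)\circ y$. A Gelfand--Dorfman (GD) algebra is a triple $(A,\circ,[\cdot,\cdot])$ such that $(A,\circ)$ is a Novikov algebra, $(A,[\cdot,\cdot])$ is a Lie algebra, and for all $x,y,z\in A$: $[x,y\circ z]-[z,y\circ x]+[y,x]\circ z-[y,z]\circ x-y\circ[x,z]=0$. The lower central series of $A$ is $A^{\langle1\rangle}=A$, $A^{\langle n+1\rangle}=\sum_{i=1}^n\bigl(A^{\langle i\rangle}\circ A^{\langle n+1-i\rangle}+[A^{\langle i\rangle},A^{\langle n+1-i\rangle}]\bigr)$ (linear spans); $A$ is nilpotent if $A^{\langle N\rangle}=0$ for some $N\ge1$. The Novikov algebra $(A,\circ)$ is nilpotent if the analogous series using only $\circ$ reaches $0$. For $x\in A$ let $L_x(a)=x\circ a$, $R_x(a)=a\circ x$, $\operatorname{ad}_x(a)=[x,a]$. The multiplication algebra $\mathcal M(A)$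 is the non-unital associative subalgebra of $\operatorname{End}_{\Bbbk}(A)$ generated by all $L_x,R_x,\operatorname{ad}_x$, $x\in A$. $\mathcal I_{R\operatorname{ad}}$ is the two-sided ideal of $\mathcal M(A)$ generated by all operators $R_x\operatorname{ad}_y$ (composition), $x,y\in A$. *)

theory Defs
  imports Complex_Main "HOL-Computational_Algebra.Polynomial" "HOL-Library.Function_Algebras"
begin

locale bilinear_product = vector_space scale
  for scale :: "'k::field \<Rightarrow> 'a::ab_group_add \<Rightarrow> 'a" +
  fixes prd :: "'a \<Rightarrow> 'a \<Rightarrow> 'a"
  assumes linear_right: "\<And>x. Vector_Spaces.linear scale scale (\<lambda>a. prd x a)"
    and linear_left: "\<And>x. Vector_Spaces.linear scale scale (\<lambda>a. prd a x)"

locale novikov_algebra = bilinear_product scale mul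
  for scale :: "'k::field \<Rightarrow> 'a::ab_group_add \<Rightarrow> 'a"
    and mul :: "'a \<Rightarrow> 'a \<Rightarrow> 'a"  (infixl \<open>\<odot>\<close> 70) +
  assumes left_symmetric:
      "(x \<odot> y) \<odot> z - x \<odot> (y \<odot> z) = (y \<odot> x) \<odot> z - y \<odot> (x \<odot> z)"
    and right_commutative: "(x \<odot> y) \<odot> z = (x \<odot> z) \<odot> y"

locale lie_algebra = bilinear_product scale br
  for scale :: "'k::field \<Rightarrow> 'a::ab_group_add \<Rightarrow> 'a"
    and br :: "'a \<Rightarrow> 'a \<Rightarrow> 'a" +
  assumes alternating: "br x x = 0"
    and jacobi: "br x (br y z) + br y (br z x) + br z (br x y) = 0"

locale gd_algebra = novikov_algebra scale mul + lie: lie_algebra scale br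
  for scale :: "'k::field \<Rightarrow> 'a::ab_group_add \<Rightarrow> 'a"
    and mul :: "'a \<Rightarrow> 'a \<Rightarrow> 'a"  (infixl \<open>\<odot>\<close> 70)
    and br :: "'a \<Rightarrow> 'a \<Rightarrow> 'a" +
  assumes compatible:
    "br x (y \<odot> z) - br z (y \<odot> x) + br y x \<odot> z - br y z \<odot> x - y \<odot> br x z = 0"

definition finite_dimensional :: "('k::field \<Rightarrow> 'a::ab_group_add \<Rightarrow> 'a) \<Rightarrow> bool"
  where "finite_dimensional scale \<longleftrightarrow> (\<exists>B. finite B \<and> module.span scale B = UNIV)"


text \<open>
  The lower central series with respect to a set of products \<open>P\<close> on the whole space: term
  \<open>n + 1\<close> is the span of all \<open>p x y\<close> with \<open>p\<close> in \<open>P\<close> and \<open>x\<close>, \<open>y\<close> in terms \<open>i\<close> and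
  \<open>n + 1 - i\<close> for \<open>1 \<le> i \<le> n\<close>.  The series starts at index 1; the value at index 0 is a dummy.
\<close>

fun lower_central ::
  "('k::field \<Rightarrow> 'a::ab_group_add \<Rightarrow> 'a) \<Rightarrow> ('a \<Rightarrow> 'a \<Rightarrow> 'a) set \<Rightarrow> nat \<Rightarrow> 'a set"
where
  "lower_central scale P 0 = UNIV"
| "lower_central scale P (Suc 0) = UNIV"
| "lower_central scale P (Suc (Suc m)) =
    module.span scale
      (\<Union>i\<in>{1..Suc m}. {p x y | p x y. p \<in> P
         \<and> x \<in> lower_central scale P i \<and> y \<in> lower_central scale P (Suc (Suc m) - i)})"

definition gd_nilpotent ::
  "('k::field \<Rightarrow> 'a::ab_group_add \<Rightarrow> 'a) \<Rightarrow> ('a \<Rightarrow> 'a \<Rightarrow> 'a) \<Rightarrow> ('a \<Rightarrow> 'a \<Rightarrow> 'a) \<Rightarrow> bool"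
  where "gd_nilpotent scale mul br \<longleftrightarrow> (\<exists>N\<ge>1. lower_central scale {mul, br} N = {0})"

definition novikov_nilpotent ::
  "('k::field \<Rightarrow> 'a::ab_group_add \<Rightarrow> 'a) \<Rightarrow> ('a \<Rightarrow> 'a \<Rightarrow> 'a) \<Rightarrow> bool"
  where "novikov_nilpotent scale mul \<longleftrightarrow> (\<exists>N\<ge>1. lower_central scale {mul} N = {0})"

text \<open>For Lie algebras, the usual series \<open>L\<close>, \<open>[L, L]\<close>, \<open>[L, [L, L]]\<close> and so on, indexed from 0.\<close>

primrec lie_lower_central ::
  "('k::field \<Rightarrow> 'a::ab_group_add \<Rightarrow> 'a) \<Rightarrow> ('a \<Rightarrow> 'a \<Rightarrow> 'a) \<Rightarrow> nat \<Rightarrow> 'a set"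
where
  "lie_lower_central scale br 0 = UNIV"
| "lie_lower_central scale br (Suc n) =
    module.span scale {br x y | x y. y \<in> lie_lower_central scale br n}"

definition lie_nilpotent ::
  "('k::field \<Rightarrow> 'a::ab_group_add \<Rightarrow> 'a) \<Rightarrow> ('a \<Rightarrow> 'a \<Rightarrow> 'a) \<Rightarrow> bool"
  where "lie_nilpotent scale br \<longleftrightarrow> (\<exists>n. lie_lower_central scale br n = {0})"


text \<open>
  Operators are functions \<open>'a \<Rightarrow> 'a\<close> with the pointwise vector space structure.  All operators
  \<open>L\<^sub>x\<close>, \<open>R\<^sub>x\<close>, \<open>ad\<^sub>x\<close> are linear, and linear maps are closed under the algebra operations, so the
  subalgebra they generate among all functions is the one they generate in the endomorphism
  algebra.
\<close>

definition op_scale :: "('k \<Rightarrow> 'a \<Rightarrow> 'a) \<Rightarrow> 'k \<Rightarrow> ('a \<Rightarrow> 'a) \<Rightarrow> 'a \<Rightarrow> 'a"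
  where "op_scale scale c f = (\<lambda>a. scale c (f a))"

definition op_subalgebra ::
  "('k::field \<Rightarrow> 'a::ab_group_add \<Rightarrow> 'a) \<Rightarrow> ('a \<Rightarrow> 'a) set \<Rightarrow> bool"
  where "op_subalgebra scale S \<longleftrightarrow>
    module.subspace (op_scale scale) S \<and> (\<forall>f\<in>S. \<forall>g\<in>S. f \<circ> g \<in> S)"

definition op_ideal ::
  "('k::field \<Rightarrow> 'a::ab_group_add \<Rightarrow> 'a) \<Rightarrow> ('a \<Rightarrow> 'a) set \<Rightarrow> ('a \<Rightarrow> 'a) set \<Rightarrow> bool"
  where "op_ideal scale M J \<longleftrightarrow>
    J \<subseteq> M \<and> module.subspace (op_scale scale) J \<and> (\<forall>m\<in>M. \<forall>f\<in>J. m \<circ> f \<in> J \<and> f \<circ> m \<in> J)"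

definition L_op :: "('a \<Rightarrow> 'a \<Rightarrow> 'a) \<Rightarrow> 'a \<Rightarrow> 'a \<Rightarrow> 'a"
  where "L_op mul x = (\<lambda>a. mul x a)"

definition R_op :: "('a \<Rightarrow> 'a \<Rightarrow> 'a) \<Rightarrow> 'a \<Rightarrow> 'a \<Rightarrow> 'a"
  where "R_op mul x = (\<lambda>a. mul a x)"

definition ad_op :: "('a \<Rightarrow> 'a \<Rightarrow> 'a) \<Rightarrow> 'a \<Rightarrow> 'a \<Rightarrow> 'a"
  where "ad_op br x = (\<lambda>a. br x a)"

definition mult_algebra ::
  "('k::field \<Rightarrow> 'a::ab_group_add \<Rightarrow> 'a) \<Rightarrow> ('a \<Rightarrow> 'a \<Rightarrow> 'a) \<Rightarrow> ('a \<Rightarrow> 'a \<Rightarrow> 'a) \<Rightarrow> ('a \<Rightarrow> 'a) set"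
  where "mult_algebra scale mul br =
    op_subalgebra scale hull (range (L_op mul) \<union> range (R_op mul) \<union> range (ad_op br))"

definition I_Rad ::
  "('k::field \<Rightarrow> 'a::ab_group_add \<Rightarrow> 'a) \<Rightarrow> ('a \<Rightarrow> 'a \<Rightarrow> 'a) \<Rightarrow> ('a \<Rightarrow> 'a \<Rightarrow> 'a) \<Rightarrow> ('a \<Rightarrow> 'a) set"
  where "I_Rad scale mul br =
    op_ideal scale (mult_algebra scale mul br) hull {R_op mul x \<circ> ad_op br y | x y. True}"

text \<open>\<open>op_power scale J n\<close> is the power \<open>J\<^sup>n\<^sup>+\<^sup>1\<close> (spans of products), starting at \<open>J\<^sup>1 = J\<close>.\<close>

primrec op_power ::
  "('k::field \<Rightarrow> 'a::ab_group_add \<Rightarrow> 'a) \<Rightarrow> ('a \<Rightarrow> 'a) set \<Rightarrow> nat \<Rightarrow> ('a \<Rightarrow> 'a) set"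
where
  "op_power scale J 0 = J"
| "op_power scale J (Suc n) =
    module.span (op_scale scale) {f \<circ> g | f g. f \<in> J \<and> g \<in> op_power scale J n}"

definition op_nilpotent ::
  "('k::field \<Rightarrow> 'a::ab_group_add \<Rightarrow> 'a) \<Rightarrow> ('a \<Rightarrow> 'a) set \<Rightarrow> bool"
  where "op_nilpotent scale J \<longleftrightarrow> (\<exists>n. op_power scale J n = {0})"

end

theory Submission
  imports Defs
begin

text \<open>
  If \<open>A\<close> is nilpotent, every operator \<open>L\<^sub>x\<close>, \<open>R\<^sub>x\<close>, \<open>ad\<^sub>x\<close> pushes the lower central series at
  least one step down, hence so does every element of the multiplication algebra; a product of
  many elements of the ideal vanishes (\<open>op_power_raises_central_degree\<close>).

  For the converse, write \<open>I\<close> for the ideal generated by the \<open>R\<^sub>x ad\<^sub>y\<close>, and let \<open>A\<^sub>i = I\<^sup>i A\<close>.  These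
  are finitely many invariant subspaces descending from \<open>A\<close> to \<open>0\<close>, and \<open>R\<^sub>x ad\<^sub>y\<close> maps \<open>A\<^sub>i\<close> to
  \<open>A\<^sub>i\<^sub>+\<^sub>1\<close>.  They are used in two roles.

  As modules: it suffices that long words in \<open>L\<close>, \<open>R\<close>, \<open>ad\<close> vanish on each factor
  \<open>A\<^sub>i / A\<^sub>i\<^sub>+\<^sub>1\<close>, on which \<open>R\<^sub>x ad\<^sub>y = 0\<close>.  Read as an operator identity, the compatibility axiom
  then says
  \<open>[ad\<^sub>x, L\<^sub>y] = - ad\<^bsub>y\<circ>x\<^esub> - L\<^bsub>[y,x]\<^esub>\<close>  (\<open>ad_L_commutator\<close>),
  so words in \<open>L\<close> and \<open>ad\<close> can be sorted, at the price of more complicated indices.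

  As index sets, this price is bounded: alternating brackets and right multiplications moves an
  index down the chain \<open>A\<^sub>i\<close>.  By recursion on \<open>i\<close> (\<open>L_ad_descent\<close>), on a factor where the
  \<open>ad\<^sub>v\<close> with \<open>v \<in> A\<^sub>i\<^sub>+\<^sub>1\<close> vanish, the operators \<open>L\<^sub>u\<close> with \<open>u \<in> [A, A\<^sub>i]\<close> commute with all \<open>ad\<^sub>x\<close> up
  to operators of the same kind, because \<open>u \<circ> x \<in> A\<^sub>i\<^sub>+\<^sub>1\<close>.  A word with many such \<open>L\<^sub>u\<close> can
  therefore be sorted into a long word in \<open>L\<close> followed by \<open>ad\<close>s, which vanishes by nilpotency of
  the Novikov algebra.  Where these \<open>L\<^sub>u\<close> vanish too, the same argument with the roles of \<open>L\<close> and
  \<open>ad\<close> exchanged uses nilpotency of the Lie algebra to remove the \<open>ad\<^sub>v\<close> with \<open>v \<in> A\<^sub>i\<close>.  At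
  \<open>i = 0\<close> all \<open>ad\<close> are gone and only words in \<open>L\<close> remain.  Finally \<open>R\<^sub>z L\<^sub>x = L\<^bsub>x\<circ>z\<^esub>\<close> absorbs right
  multiplications into \<open>L\<close> (\<open>full_descent_of_L_ad_descent\<close>).

  Both sorting arguments are instances of \<open>refine_by_nilpotent_family\<close>.
\<close>

section \<open>Descents in a vector space with products\<close>

definition left_invariant :: "('a \<Rightarrow> 'a \<Rightarrow> 'a) \<Rightarrow> 'a set \<Rightarrow> bool"
  where "left_invariant p W \<longleftrightarrow> (\<forall>x. \<forall>w\<in>W. p x w \<in> W)"

text \<open>
  Vanishing of long words on a factor space \<open>W / T\<close> is expressed without quotients and without
  words, by a chain of subspaces from \<open>W\<close> to \<open>T\<close> along which every operator moves one step down.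
  Such chains can be refined and concatenated.
\<close>

definition descent_step ::
  "('k::field \<Rightarrow> 'a::ab_group_add \<Rightarrow> 'a) \<Rightarrow> ('a \<Rightarrow> 'a \<Rightarrow> 'a) set \<Rightarrow> 'a set \<Rightarrow> 'a set \<Rightarrow> bool"
  where "descent_step scale P W W' \<longleftrightarrow>
    module.subspace scale W \<and> module.subspace scale W' \<and> W' \<subseteq> W \<and>
    (\<forall>p\<in>P. \<forall>x. \<forall>w\<in>W. p x w \<in> W')"

abbreviation descends ::
  "('k::field \<Rightarrow> 'a::ab_group_add \<Rightarrow> 'a) \<Rightarrow> ('a \<Rightarrow> 'a \<Rightarrow> 'a) set \<Rightarrow> 'a set \<Rightarrow> 'a set \<Rightarrow> bool"
  where "descends scale P \<equiv> (descent_step scale P)\<^sup>*\<^sup>*"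

lemmas linear_map_hom = module_hom_iff_linear[THEN iffD2]
lemmas linear_map_add = module_hom.add[OF linear_map_hom]
lemmas linear_map_0 = module_hom.zero[OF linear_map_hom]
lemmas linear_map_neg = module_hom.neg[OF linear_map_hom]
lemmas linear_map_scale = module_hom.scale[OF linear_map_hom]
lemmas linear_map_subspace_vimage = module_hom.subspace_vimage[OF linear_map_hom]

context vector_space
begin

lemma descends_subset: "descends scale P W T \<Longrightarrow> T \<subseteq> W"
  by (induction rule: rtranclp_induct) (auto simp: descent_step_def)

lemma subspace_lie_lower_central: "subspace (lie_lower_central scale p n)"
  by (cases n) (auto simp: subspace_UNIV)

lemma lie_lower_central_product:
  "y \<in> lie_lower_central scale p n \<Longrightarrow> p x y \<in> lie_lower_central scale p (Suc n)"
  by (auto intro!: span_base)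

text \<open>
  The series \<open>lie_lower_central\<close> makes sense for an arbitrary product \<open>p\<close>: its \<open>n\<close>-th term is spanned by
  the values of words of length \<open>n\<close> in the operators \<open>p x\<close>.  It is used below for \<open>L\<close>, \<open>R\<close> and \<open>ad\<close>.
\<close>

lemma lie_lower_central_decreasing:
  "lie_lower_central scale p (Suc n) \<subseteq> lie_lower_central scale p n"
proof (induction n)
  case (Suc n)
  then show ?case
    unfolding lie_lower_central.simps(2)[of scale p "Suc n"] lie_lower_central.simps(2)[of scale p n]
    by (intro span_mono) blast
qed simp

text \<open>
  The subspace \<open>H\<close> is generated modulo \<open>T\<close> by the values \<open>a v w\<close> with \<open>v \<in> V\<close>, \<open>w \<in> X\<close> under the
  operators \<open>a x\<close> alone.  It is nevertheless invariant under \<open>b\<close>: the commutation rules move any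
  \<open>b x\<close> to the right past the operators \<open>a y\<close> and then past \<open>a v\<close>, where it is swallowed by \<open>X\<close>.
\<close>

lemma saturated_submodule:
  fixes a b :: "'b \<Rightarrow> 'b \<Rightarrow> 'b"
  assumes lin: "\<And>x. Vector_Spaces.linear scale scale (b x)"
    and sub: "subspace X" "subspace T" "T \<subseteq> X" "X \<subseteq> W"
    and st: "left_invariant a X" "left_invariant b X" "left_invariant b T"
    and comm: "\<And>w x y. w \<in> W \<Longrightarrow> \<exists>p q. b x (a y w) - (a y (b x w) + a p w + b q w) \<in> T"
    and comm_V: "\<And>w x v. w \<in> W \<Longrightarrow> v \<in> V \<Longrightarrow> \<exists>p\<in>V. b x (a v w) - (a v (b x w) + a p w) \<in> T"
  obtains H where "subspace H" "T \<subseteq> H" "H \<subseteq> X" "left_invariant a H" "left_invariant b H"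
    and "\<And>v w. v \<in> V \<Longrightarrow> w \<in> X \<Longrightarrow> a v w \<in> H"
    and "\<And>Y. subspace Y \<Longrightarrow> T \<subseteq> Y \<Longrightarrow> left_invariant a Y \<Longrightarrow> (\<And>v w. v \<in> V \<Longrightarrow> w \<in> X \<Longrightarrow> a v w \<in> Y)
           \<Longrightarrow> H \<subseteq> Y"
proof -
  define good where "good Y \<longleftrightarrow>
    subspace Y \<and> T \<subseteq> Y \<and> left_invariant a Y \<and> (\<forall>v\<in>V. \<forall>w\<in>X. a v w \<in> Y)" for Y
  define H where "H = \<Inter>{Y. good Y}"
  have goodX: "good X" using sub st by (auto simp: good_def left_invariant_def)
  have goodH: "good H"
    unfolding good_def H_def left_invariant_def
    by (auto intro!: subspace_Inter simp: good_def left_invariant_def)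
  have least: "H \<subseteq> Y" if "good Y" for Y using that by (auto simp: H_def)
  have HX: "H \<subseteq> X" by (rule least[OF goodX])
  have H: "subspace H" "T \<subseteq> H" "left_invariant a H" "\<And>v w. v \<in> V \<Longrightarrow> w \<in> X \<Longrightarrow> a v w \<in> H"
    using goodH by (auto simp: good_def)
  have mod_T: "h \<in> H" if "h - g \<in> T" "g \<in> H" for h g
    using subspace_add[OF H(1) _ that(2), of "h - g"] that(1) H(2) by auto
  \<comment> \<open>By minimality of \<open>H\<close> it is enough that \<open>G\<close> has the closure properties defining \<open>H\<close>.\<close>
  define G where "G = {w \<in> H. \<forall>x. b x w \<in> H}"
  have "subspace G"
    unfolding G_def
  proof (rule subspaceI)
    fix u v c
    show "0 \<in> {w \<in> H. \<forall>x. b x w \<in> H}"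
      using subspace_0[OF H(1)] linear_map_0[OF lin] by auto
    show "u + v \<in> {w \<in> H. \<forall>x. b x w \<in> H}"
      if "u \<in> {w \<in> H. \<forall>x. b x w \<in> H}" "v \<in> {w \<in> H. \<forall>x. b x w \<in> H}"
      using that subspace_add[OF H(1)] linear_map_add[OF lin] by auto
    show "scale c u \<in> {w \<in> H. \<forall>x. b x w \<in> H}" if "u \<in> {w \<in> H. \<forall>x. b x w \<in> H}"
      using that subspace_scale[OF H(1)] linear_map_scale[OF lin] by auto
  qed
  moreover have "T \<subseteq> G" using H(2) st(3) by (auto simp: G_def left_invariant_def)
  moreover have "left_invariant a G"
    unfolding left_invariant_def
  proof (intro allI ballI)
    fix y w assume w: "w \<in> G"
    have "b x (a y w) \<in> H" for x
    proof -
      obtain p q where "b x (a y w) - (a y (b x w) + a p w + b q w) \<in> T"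
        using comm[of w x y] w HX sub(4) by (auto simp: G_def)
      then show ?thesis
        by (rule mod_T) (use w H(3) in \<open>auto simp: G_def left_invariant_def intro!: subspace_add[OF H(1)]\<close>)
    qed
    then show "a y w \<in> G" using w H(3) by (auto simp: G_def left_invariant_def)
  qed
  moreover have "a v w \<in> G" if vw: "v \<in> V" "w \<in> X" for v w
  proof -
    have "b x (a v w) \<in> H" for x
    proof -
      obtain p where p: "p \<in> V" "b x (a v w) - (a v (b x w) + a p w) \<in> T"
        using comm_V[of w v x] vw sub(4) by auto
      have "b x w \<in> X" using st(2) vw(2) by (auto simp: left_invariant_def)
      then show ?thesis
        using p(2) by (rule_tac mod_T) (auto intro!: subspace_add[OF H(1)] H(4) p(1) vw)
    qed
    then show ?thesis using H(4)[OF vw] by (auto simp: G_def)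
  qed
  ultimately have "good G" by (auto simp: good_def)
  then have "left_invariant b H" using least[of G] by (auto simp: G_def left_invariant_def)
  then show ?thesis
    using that[of H] H HX least by (auto simp: good_def)
qed

text \<open>
  Iterating \<open>saturated_submodule\<close> from \<open>W\<close> gives after \<open>m\<close> steps a subspace inside
  \<open>T + F m\<close>, where \<open>F\<close> is the series of words in \<open>a\<close>; this reaches \<open>T\<close> as \<open>F\<close> reaches \<open>0\<close>.  On each
  layer of this filtration the operators \<open>a v\<close> with \<open>v \<in> V\<close> vanish, so in proving that \<open>W\<close> descends
  to \<open>T\<close> one may assume this vanishing.
\<close>

lemma refine_by_nilpotent_family:
  fixes a b :: "'b \<Rightarrow> 'b \<Rightarrow> 'b"
  assumes lin_a: "\<And>x. Vector_Spaces.linear scale scale (a x)"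
    and lin_b: "\<And>x. Vector_Spaces.linear scale scale (b x)"
    and nil: "lie_lower_central scale a N = {0}"
    and sub: "subspace W" "subspace T" "T \<subseteq> W"
    and st: "left_invariant a W" "left_invariant b W" "left_invariant a T" "left_invariant b T"
    and comm: "\<And>w x y. w \<in> W \<Longrightarrow> \<exists>p q. b x (a y w) - (a y (b x w) + a p w + b q w) \<in> T"
    and comm_V: "\<And>w x v. w \<in> W \<Longrightarrow> v \<in> V \<Longrightarrow> \<exists>p\<in>V. b x (a v w) - (a v (b x w) + a p w) \<in> T"
    and step: "\<And>X X'. subspace X \<Longrightarrow> subspace X' \<Longrightarrow> T \<subseteq> X' \<Longrightarrow> X' \<subseteq> X \<Longrightarrow> X \<subseteq> W \<Longrightarrow>
      left_invariant a X \<Longrightarrow> left_invariant b X \<Longrightarrow> left_invariant a X' \<Longrightarrow> left_invariant b X' \<Longrightarrow>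
      (\<And>v w. v \<in> V \<Longrightarrow> w \<in> X \<Longrightarrow> a v w \<in> X') \<Longrightarrow> descends scale P X X'"
  shows "descends scale P W T"
proof -
  let ?F = "lie_lower_central scale a"
  let ?S = "\<lambda>m. {t + f | t f. t \<in> T \<and> f \<in> ?F m}"
  have "descends scale P X T"
    if "m + k = N" "subspace X" "T \<subseteq> X" "X \<subseteq> W" "left_invariant a X" "left_invariant b X" "X \<subseteq> ?S m" for m k X
    using that
  proof (induction k arbitrary: m X)
    case 0
    then have "X = T" using nil by auto
    then show ?case by simp
  next
    case (Suc k)
    obtain H where H: "subspace H" "T \<subseteq> H" "H \<subseteq> X" "left_invariant a H" "left_invariant b H"
      and into: "\<And>v w. v \<in> V \<Longrightarrow> w \<in> X \<Longrightarrow> a v w \<in> H"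
      and least: "\<And>Y. subspace Y \<Longrightarrow> T \<subseteq> Y \<Longrightarrow> left_invariant a Y \<Longrightarrow>
        (\<And>v w. v \<in> V \<Longrightarrow> w \<in> X \<Longrightarrow> a v w \<in> Y) \<Longrightarrow> H \<subseteq> Y"
      by (rule saturated_submodule[of b X T W a V, OF lin_b Suc.prems(2) sub(2) Suc.prems(3-6) st(4) comm comm_V])
        blast+
    have shift: "a x w \<in> ?S (Suc m)" if "w \<in> ?S m" for x w
    proof -
      obtain t f where w: "w = t + f" "t \<in> T" "f \<in> ?F m" using \<open>w \<in> ?S m\<close> by blast
      have "a x w = a x t + a x f" using w(1) linear_map_add[OF lin_a] by simp
      moreover have "a x t \<in> T" using st(3) w(2) by (auto simp: left_invariant_def)
      moreover have "a x f \<in> ?F (Suc m)" by (rule lie_lower_central_product[OF w(3)])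
      ultimately show ?thesis by blast
    qed
    have smaller: "?S (Suc m) \<subseteq> ?S m" using lie_lower_central_decreasing[of a m] by blast
    have "subspace (?S (Suc m))"
      by (rule subspace_sums[OF sub(2) subspace_lie_lower_central])
    moreover have "T \<subseteq> ?S (Suc m)"
    proof
      fix t assume "t \<in> T"
      moreover have "t = t + 0" "0 \<in> ?F (Suc m)"
        using subspace_0[OF subspace_lie_lower_central] by (simp, blast)
      ultimately show "t \<in> ?S (Suc m)" by blast
    qed
    moreover have "left_invariant a (?S (Suc m))"
      unfolding left_invariant_def
    proof (intro allI ballI)
      fix x w assume "w \<in> ?S (Suc m)"
      then show "a x w \<in> ?S (Suc m)" by (rule shift[OF subsetD[OF smaller]])
    qed
    ultimately have below: "H \<subseteq> ?S (Suc m)"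
      using shift[OF subsetD[OF Suc.prems(7)]] by (rule least)
    have "descends scale P X H"
      by (rule step[OF Suc.prems(2) H(1-3) Suc.prems(4-6) H(4,5) into])
    moreover have "descends scale P H T"
      by (rule Suc.IH[OF _ H(1,2) order_trans[OF H(3) Suc.prems(4)] H(4,5) below])
        (use Suc.prems(1) in simp)
    ultimately show ?case by (rule rtranclp_trans)
  qed
  note main = this
  have "W \<subseteq> ?S 0"
  proof
    fix w
    have "w = 0 + w" "w \<in> ?F 0" by simp_all
    then show "w \<in> ?S 0" using subspace_0[OF sub(2)] by blast
  qed
  then show ?thesis by (rule main[OF add_0 sub(1,3) order_refl st(1,2)])
qed

lemma subspace_lower_central: "subspace (lower_central scale P n)"
  by (cases "(scale, P, n)" rule: lower_central.cases) (auto simp: subspace_UNIV)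

lemma lower_central_product:
  assumes "p \<in> P" "x \<in> lower_central scale P i" "y \<in> lower_central scale P j" "i \<ge> 1" "j \<ge> 1"
  shows "p x y \<in> lower_central scale P (i + j)"
proof -
  define m where "m = i + j - 2"
  then have m: "i + j = Suc (Suc m)" "i \<in> {1..Suc m}" "j = Suc (Suc m) - i"
    using assms(4,5) by auto
  then show ?thesis
    unfolding m(1) lower_central.simps using assms(1-3) m(2,3) by (intro span_base) blast
qed

lemma lower_central_subsetI:
  assumes "subspace S" "n \<ge> 2"
    and "\<And>p i j x y. p \<in> P \<Longrightarrow> i \<ge> 1 \<Longrightarrow> j \<ge> 1 \<Longrightarrow> i + j = n \<Longrightarrow>
      x \<in> lower_central scale P i \<Longrightarrow> y \<in> lower_central scale P j \<Longrightarrow> p x y \<in> S"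
  shows "lower_central scale P n \<subseteq> S"
proof -
  have m: "n = Suc (Suc (n - 2))" using assms(2) by simp
  show ?thesis
    unfolding lower_central.simps(3)[of scale P "n - 2", folded m]
  proof (rule span_minimal[OF _ assms(1)], clarify)
    fix i p x y
    assume "i \<in> {1..Suc (n - 2)}" "p \<in> P" "x \<in> lower_central scale P i"
      "y \<in> lower_central scale P (n - i)"
    then show "p x y \<in> S" using m by (intro assms(3)[of p i "n - i"]) auto
  qed
qed

lemma lower_central_decreasing:
  "lower_central scale P (Suc n) \<subseteq> lower_central scale P n"
proof (induction n rule: less_induct)
  case (less n)
  consider "n = 0" | "n = 1" | "n \<ge> 2" by linarith
  then show ?case
  proof cases
    case 3
    show ?thesis
    proof (rule lower_central_subsetI[OF subspace_lower_central])
      fix p i j x y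
      assume *: "p \<in> P" "i \<ge> 1" "j \<ge> 1" "i + j = Suc n"
        "x \<in> lower_central scale P i" "y \<in> lower_central scale P j"
      show "p x y \<in> lower_central scale P n"
      proof (cases "i = 1")
        case True
        then have "y \<in> lower_central scale P (n - 1)"
          using less[of "n - 1"] * 3 by auto
        then show ?thesis using lower_central_product[OF *(1,5), of y "n - 1"] * 3 True by simp
      next
        case False
        have "lower_central scale P (Suc (i - 1)) \<subseteq> lower_central scale P (i - 1)"
          by (rule less) (use * in linarith)
        then have "x \<in> lower_central scale P (i - 1)" using *(2,5) by auto
        then show ?thesis using lower_central_product[OF *(1) _ *(6), of x "i - 1"] * 3 False by simp
      qed
    qed (use 3 in simp)
  qed simp_all
qed

lemma lower_central_antimono:
  "m \<le> n \<Longrightarrow> lower_central scale P n \<subseteq> lower_central scale P m"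
  by (rule lift_Suc_antimono_le[of "lower_central scale P"]) (rule lower_central_decreasing)

lemma lower_central_mono:
  assumes "P \<subseteq> P'" 
  shows "lower_central scale P n \<subseteq> lower_central scale P' n"
proof (induction n rule: less_induct)
  case (less n)
  show ?case
  proof (cases "n \<ge> 2")
    case True
    show ?thesis
    proof (rule lower_central_subsetI[OF subspace_lower_central True])
      fix p i j x y
      assume *: "p \<in> P" "i \<ge> 1" "j \<ge> 1" "i + j = n"
        "x \<in> lower_central scale P i" "y \<in> lower_central scale P j"
      then have "x \<in> lower_central scale P' i" "y \<in> lower_central scale P' j"
        using less[of i] less[of j] by auto
      then show "p x y \<in> lower_central scale P' n"
        using lower_central_product[of p P' x i y j] * assms by auto
    qed
  next
    case False
    then consider "n = 0" | "n = Suc 0" by linarith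
    then show ?thesis by cases simp_all
  qed
qed

lemma lie_lower_central_subset:
  assumes "p \<in> P"
  shows "lie_lower_central scale p n \<subseteq> lower_central scale P (Suc n)"
proof (induction n)
  case (Suc n)
  have "{p x y | x y. y \<in> lie_lower_central scale p n} \<subseteq> lower_central scale P (Suc (Suc n))"
    using Suc lower_central_product[of p P _ 1 _ "Suc n"] assms by auto
  then show ?case
    unfolding lie_lower_central.simps by (rule span_minimal[OF _ subspace_lower_central])
qed simp

lemma lie_lower_central_flip_subset:
  assumes "p \<in> P"
  shows "lie_lower_central scale (\<lambda>x y. p y x) n \<subseteq> lower_central scale P (Suc n)"
proof (induction n)
  case (Suc n)
  have "{p y x | x y. y \<in> lie_lower_central scale (\<lambda>x y. p y x) n}
      \<subseteq> lower_central scale P (Suc (Suc n))"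
    using Suc lower_central_product[of p P _ "Suc n" _ 1] assms by auto
  then show ?case
    unfolding lie_lower_central.simps by (rule span_minimal[OF _ subspace_lower_central])
qed simp

text \<open>
  A product of degree at least \<open>2n\<close> has a factor of degree at least \<open>n\<close>, so doubling the degree
  buys one step of the descent.
\<close>

lemma lower_central_below_descent:
  assumes "descends scale P' UNIV T"
    and two_sided: "\<And>W W' p x w. descent_step scale P' W W' \<Longrightarrow> p \<in> P \<Longrightarrow> w \<in> W \<Longrightarrow>
      p x w \<in> W' \<and> p w x \<in> W'"
  shows "\<exists>n\<ge>1. \<forall>m\<ge>n. lower_central scale P m \<subseteq> T"
  using assms(1)
proof (induction rule: rtranclp_induct)
  case base
  then show ?case by auto
next
  case (step W W')
  obtain n where n: "n \<ge> 1" "\<And>m. m \<ge> n \<Longrightarrow> lower_central scale P m \<subseteq> W"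
    using step.IH by blast
  have W': "subspace W'" using step.hyps by (simp add: descent_step_def)
  have "lower_central scale P m \<subseteq> W'" if "m \<ge> 2 * n" for m
  proof (rule lower_central_subsetI[OF W'])
    fix p i j x y
    assume *: "p \<in> P" "i + j = m" "x \<in> lower_central scale P i" "y \<in> lower_central scale P j"
    have "i \<ge> n \<or> j \<ge> n" using *(2) that by linarith
    then have "x \<in> W \<or> y \<in> W" using n(2) *(3,4) by blast
    then show "p x y \<in> W'"
      using two_sided[OF step.hyps(2) *(1)] by blast
  qed (use that n(1) in linarith)
  then show ?case using n(1) by (intro exI[of _ "2 * n"]) auto
qed

end

section \<open>Gelfand--Dorfman algebras\<close>

context gd_algebra
begin

lemma br_lin: "Vector_Spaces.linear scale scale (br x)" "Vector_Spaces.linear scale scale (\<lambda>a. br a x)"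
  by (rule lie.linear_right, rule lie.linear_left)

lemma mul_lin: "Vector_Spaces.linear scale scale ((\<odot>) x)" "Vector_Spaces.linear scale scale (\<lambda>a. a \<odot> x)"
  by (rule linear_right, rule linear_left)

lemmas br_add = linear_map_add[OF br_lin(1)] linear_map_add[OF br_lin(2)]
lemmas br_neg = linear_map_neg[OF br_lin(1)] linear_map_neg[OF br_lin(2)]
lemmas br_zero = linear_map_0[OF br_lin(1)] linear_map_0[OF br_lin(2)]
lemmas mul_neg = linear_map_neg[OF mul_lin(1)] linear_map_neg[OF mul_lin(2)]
lemmas mul_zero = linear_map_0[OF mul_lin(1)] linear_map_0[OF mul_lin(2)]

lemma br_anticommute: "br x y = - br y x"
proof -
  have "br (x + y) (x + y) = 0" by (rule lie.alternating)
  then have "br x y + br y x = 0" unfolding br_add by (simp add: lie.alternating add.commute)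
  then show ?thesis by (rule eq_neg_iff_add_eq_0[THEN iffD2])
qed

text \<open>
  This is the compatibility axiom with \<open>w\<close> in the place of \<open>z\<close>, that is,
  \<open>[ad\<^sub>x, L\<^sub>y] = L\<^bsub>[x,y]\<^esub> - ad\<^bsub>y\<circ>x\<^esub> + R\<^sub>x ad\<^sub>y\<close>.
\<close>

lemma ad_L_commutator:
  "br x (y \<odot> w) = y \<odot> br x w + br x y \<odot> w + br (- (y \<odot> x)) w + br y w \<odot> x"
proof -
  have "br x (y \<odot> w) = br w (y \<odot> x) - br y x \<odot> w + br y w \<odot> x + y \<odot> br x w"
    using compatible[of x y w] by (simp add: algebra_simps)
  then show ?thesis
    using br_anticommute[of w "y \<odot> x"] br_anticommute[of y x] by (simp add: br_neg mul_neg)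
qed

text \<open>
  The factor \<open>W / T\<close> is not required to be invariant under right multiplications: the layers
  produced by \<open>refine_by_L\<close> and \<open>refine_by_ad\<close> need not be.
\<close>

definition R_ad_trivial :: "'a set \<Rightarrow> 'a set \<Rightarrow> bool"
  where "R_ad_trivial W T \<longleftrightarrow>
    subspace W \<and> subspace T \<and> T \<subseteq> W \<and>
    left_invariant mul W \<and> left_invariant br W \<and> left_invariant mul T \<and> left_invariant br T \<and>
    (\<forall>x y. \<forall>w\<in>W. br y w \<odot> x \<in> T)"

lemma R_ad_trivialD:
  assumes "R_ad_trivial W T"
  shows "subspace W" "subspace T" "T \<subseteq> W" "left_invariant mul W" "left_invariant br W"
    "left_invariant mul T" "left_invariant br T" "w \<in> W \<Longrightarrow> br y w \<odot> x \<in> T"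
  using assms by (simp_all add: R_ad_trivial_def)

lemma R_ad_trivial_between:
  assumes "R_ad_trivial W T" "subspace X" "subspace X'" "T \<subseteq> X'" "X' \<subseteq> X" "X \<subseteq> W"
    "left_invariant mul X" "left_invariant br X" "left_invariant mul X'" "left_invariant br X'"
  shows "R_ad_trivial X X'"
  unfolding R_ad_trivial_def
  using assms(2-) R_ad_trivialD(8)[OF assms(1)] by (simp add: subset_eq)

text \<open>
  The index \<open>v \<odot> x\<close> in \<open>ad_V\<close> is the one created by commuting \<open>ad\<^sub>x\<close> past \<open>L\<^sub>v\<close>; once that term
  is zero, the family \<open>L\<^sub>v\<close>, \<open>v \<in> V\<close>, is stable under commutators with \<open>ad\<close>.
\<close>

lemma refine_by_L:
  assumes nil: "lie_lower_central scale mul N = {0}"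
    and WT: "R_ad_trivial W T"
    and V: "\<And>x v. v \<in> V \<Longrightarrow> br x v \<in> V"
    and ad_V: "\<And>x v w. v \<in> V \<Longrightarrow> w \<in> W \<Longrightarrow> br (v \<odot> x) w \<in> T"
    and step: "\<And>X X'. R_ad_trivial X X' \<Longrightarrow> T \<subseteq> X' \<Longrightarrow> X \<subseteq> W \<Longrightarrow>
      (\<And>v w. v \<in> V \<Longrightarrow> w \<in> X \<Longrightarrow> v \<odot> w \<in> X') \<Longrightarrow> descends scale P X X'"
  shows "descends scale P W T"
proof (rule refine_by_nilpotent_family[where a = mul and b = br and V = V, OF mul_lin(1) br_lin(1) nil])
  note T = R_ad_trivialD(2)[OF WT] and R = R_ad_trivialD(8)[OF WT]
  show "\<exists>p q. br x (y \<odot> w) - (y \<odot> br x w + p \<odot> w + br q w) \<in> T" if "w \<in> W" for w x y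
    using R[OF that] ad_L_commutator[of x y w]
    by (intro exI[of _ "br x y"] exI[of _ "- (y \<odot> x)"]) simp
  show "\<exists>p\<in>V. br x (v \<odot> w) - (v \<odot> br x w + p \<odot> w) \<in> T" if w: "w \<in> W" and v: "v \<in> V" for w x v
  proof (rule bexI[OF _ V[OF v, of x]])
    have "br y w \<odot> x - br (v \<odot> x) w \<in> T" for y
      by (rule subspace_diff[OF T R[OF w] ad_V[OF v w]])
    then show "br x (v \<odot> w) - (v \<odot> br x w + br x v \<odot> w) \<in> T"
      using ad_L_commutator[of x v w] by (simp add: br_neg)
  qed
  show "descends scale P X X'"
    if "subspace X" "subspace X'" "T \<subseteq> X'" "X' \<subseteq> X" "X \<subseteq> W"
      "left_invariant mul X" "left_invariant br X" "left_invariant mul X'" "left_invariant br X'"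
      "\<And>v w. v \<in> V \<Longrightarrow> w \<in> X \<Longrightarrow> v \<odot> w \<in> X'" for X X'
    by (rule step[OF R_ad_trivial_between[OF WT that(1-5)]]) (fact that)+
qed (rule R_ad_trivialD[OF WT])+

text \<open>
  The mirror image of \<open>refine_by_L\<close>: here the term \<open>L\<^bsub>[x,v]\<^esub>\<close> of the commutator is assumed to vanish,
  and words are sorted with \<open>ad\<close> on the left.
\<close>

lemma refine_by_ad:
  assumes nil: "lie_lower_central scale br N = {0}"
    and WT: "R_ad_trivial W T"
    and V: "\<And>x v. v \<in> V \<Longrightarrow> x \<odot> v \<in> V"
    and L_V: "\<And>x v w. v \<in> V \<Longrightarrow> w \<in> W \<Longrightarrow> br x v \<odot> w \<in> T"
    and step: "\<And>X X'. R_ad_trivial X X' \<Longrightarrow> T \<subseteq> X' \<Longrightarrow> X \<subseteq> W \<Longrightarrow>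
      (\<And>v w. v \<in> V \<Longrightarrow> w \<in> X \<Longrightarrow> br v w \<in> X') \<Longrightarrow> descends scale P X X'"
  shows "descends scale P W T"
proof (rule refine_by_nilpotent_family[where a = br and b = mul and V = V, OF br_lin(1) mul_lin(1) nil])
  note T = R_ad_trivialD(2)[OF WT] and R = R_ad_trivialD(8)[OF WT]
  have eq: "x \<odot> br y w = br y (x \<odot> w) + br (x \<odot> y) w + br x y \<odot> w - br x w \<odot> y" for x y w
    using ad_L_commutator[of y x w] br_anticommute[of x y] by (simp add: br_neg mul_neg)
  show "\<exists>p q. x \<odot> br y w - (br y (x \<odot> w) + br p w + q \<odot> w) \<in> T" if "w \<in> W" for w x y
    using subspace_neg[OF T R[OF that, of x y]] eq[of x y w]
    by (intro exI[of _ "x \<odot> y"] exI[of _ "br x y"]) simp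
  show "\<exists>p\<in>V. x \<odot> br v w - (br v (x \<odot> w) + br p w) \<in> T" if w: "w \<in> W" and v: "v \<in> V" for w x v
    by (rule bexI[OF _ V[OF v, of x]])
      (use subspace_diff[OF T L_V[OF v w, of x] R[OF w, of x v]] eq[of x v w] in simp)
  show "descends scale P X X'"
    if "subspace X" "subspace X'" "T \<subseteq> X'" "X' \<subseteq> X" "X \<subseteq> W"
      "left_invariant br X" "left_invariant mul X" "left_invariant br X'" "left_invariant mul X'"
      "\<And>v w. v \<in> V \<Longrightarrow> w \<in> X \<Longrightarrow> br v w \<in> X'" for X X'
    by (rule step[OF R_ad_trivial_between[OF WT that(1-5)]]) (fact that)+
qed (rule R_ad_trivialD[OF WT])+

text \<open>
  Induction on \<open>i\<close>: the hypothesis that \<open>ad\<close> vanishes for indices in \<open>A i\<close> becomes weaker as \<open>i\<close>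
  grows, and is empty once \<open>A i = 0\<close>.  The step from \<open>i\<close> to \<open>i + 1\<close> first restricts to layers on which
  \<open>L\<close> vanishes for indices in \<open>[A, A i]\<close>, then to layers on which \<open>ad\<close> vanishes for indices in \<open>A i\<close>.
\<close>

lemma L_ad_descent:
  assumes nil_L: "lie_lower_central scale mul N = {0}"
    and nil_ad: "lie_lower_central scale br M = {0}"
    and A0: "A 0 = UNIV"
    and A_mul: "\<And>i y v. v \<in> A i \<Longrightarrow> y \<odot> v \<in> A i"
    and A_br: "\<And>i y v. v \<in> A i \<Longrightarrow> br y v \<in> A i"
    and A_R_ad: "\<And>i x y v. v \<in> A i \<Longrightarrow> br y v \<odot> x \<in> A (Suc i)"
    and "R_ad_trivial W T"
    and "\<And>v w. v \<in> A i \<Longrightarrow> w \<in> W \<Longrightarrow> br v w \<in> T"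
  shows "descends scale {mul, br} W T"
  using assms(7,8)
proof (induction i arbitrary: W T)
  case 0
  show ?case
  proof (rule refine_by_L[OF nil_L 0(1), of UNIV])
    \<comment> \<open>Here all \<open>ad\<close> already act as zero, so a layer killed by \<open>L\<close> is a single step.\<close>
    show "descends scale {mul, br} X X'"
      if "R_ad_trivial X X'" "T \<subseteq> X'" "X \<subseteq> W" "\<And>v w. v \<in> UNIV \<Longrightarrow> w \<in> X \<Longrightarrow> v \<odot> w \<in> X'" for X X'
    proof (rule r_into_rtranclp)
      have "br x w \<in> X'" if "w \<in> X" for x w
        using 0(2)[of x w] A0 \<open>T \<subseteq> X'\<close> \<open>X \<subseteq> W\<close> that by blast
      then show "descent_step scale {mul, br} X X'"
        using that(4) R_ad_trivialD(1-3)[OF that(1)] by (simp add: descent_step_def)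
    qed
  qed (use 0 A0 in auto)
next
  case (Suc i)
  show ?case
  proof (rule refine_by_L[OF nil_L Suc.prems(1), of "{br y v | y v. v \<in> A i}"])
    show "br x v \<in> {br y v | y v. v \<in> A i}" if "v \<in> {br y v | y v. v \<in> A i}" for x v
      using that A_br by blast
    show "br (v \<odot> x) w \<in> T" if v: "v \<in> {br y v | y v. v \<in> A i}" and w: "w \<in> W" for x v w
    proof -
      obtain y u where "v = br y u" "u \<in> A i" using v by blast
      then show ?thesis using Suc.prems(2)[OF A_R_ad w] by simp
    qed
    fix X X'
    assume X: "R_ad_trivial X X'" "T \<subseteq> X'" "X \<subseteq> W"
      and L: "\<And>v w. v \<in> {br y v | y v. v \<in> A i} \<Longrightarrow> w \<in> X \<Longrightarrow> v \<odot> w \<in> X'"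
    show "descends scale {mul, br} X X'"
    proof (rule refine_by_ad[OF nil_ad X(1), of "A i"])
      show "descends scale {mul, br} Y Y'"
        if "R_ad_trivial Y Y'" "\<And>v w. v \<in> A i \<Longrightarrow> w \<in> Y \<Longrightarrow> br v w \<in> Y'" for Y Y'
        using that by (rule Suc.IH)
    qed (use A_mul L in blast)+
  qed
qed

text \<open>
  A given chain for \<open>L\<close> and \<open>ad\<close> may lack invariance under right multiplications.  The
  fastest such chain, \<open>W' = T + L W + ad W\<close> and so on, has it, by \<open>R\<^sub>z L\<^sub>x = L\<^bsub>x\<circ>z\<^esub>\<close> and \<open>R\<^sub>z ad\<^sub>x = 0\<close>, and stays below the
  given one.  On its layers \<open>L\<close> and \<open>ad\<close> vanish, and \<open>R\<close> is nilpotent.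
\<close>

lemma full_descent_of_L_ad_descent:
  assumes nil: "lie_lower_central scale (\<lambda>x y. y \<odot> x) N = {0}"
    and "descends scale {mul, br} C T" "R_ad_trivial W T" "W \<subseteq> C"
    and "left_invariant (\<lambda>x y. y \<odot> x) W" "left_invariant (\<lambda>x y. y \<odot> x) T"
  shows "descends scale {mul, br, \<lambda>x y. y \<odot> x} W T"
  using assms(2-6)
proof (induction arbitrary: W rule: converse_rtranclp_induct)
  case base
  then have "W = T" by (auto simp: R_ad_trivial_def)
  then show ?case by simp
next
  case (step C C')
  have C': "subspace C'" "T \<subseteq> C'" "\<And>x w. w \<in> C \<Longrightarrow> x \<odot> w \<in> C'" "\<And>x w. w \<in> C \<Longrightarrow> br x w \<in> C'"
    using step.hyps descends_subset by (auto simp: descent_step_def)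
  have W: "subspace W" "subspace T" "T \<subseteq> W" "left_invariant mul W" "left_invariant br W" "left_invariant mul T" "left_invariant br T"
    "\<And>x y w. w \<in> W \<Longrightarrow> br y w \<odot> x \<in> T"
    using step.prems(1) by (auto simp: R_ad_trivial_def)
  let ?R = "\<lambda>x y. y \<odot> x"
  define G where "G = T \<union> {x \<odot> w | x w. w \<in> W} \<union> {br x w | x w. w \<in> W}"
  define W' where "W' = span G"
  have sub': "subspace W'" by (simp add: W'_def)
  have into: "x \<odot> w \<in> W'" "br x w \<in> W'" if "w \<in> W" for x w
    using that by (auto simp: W'_def G_def intro!: span_base)
  have T': "T \<subseteq> W'" by (auto simp: W'_def G_def intro!: span_base)
  have "G \<subseteq> W" using W(3-5) by (auto simp: G_def left_invariant_def)
  then have W'W: "W' \<subseteq> W" unfolding W'_def by (rule span_minimal[OF _ W(1)])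
  have "G \<subseteq> C'" using C' step.prems(2) by (auto simp: G_def)
  then have W'C': "W' \<subseteq> C'" unfolding W'_def by (rule span_minimal[OF _ C'(1)])
  have stR: "left_invariant ?R W'"
    unfolding left_invariant_def
  proof (intro allI ballI)
    fix z w assume "w \<in> W'"
    then have "w \<in> span G" by (simp add: W'_def)
    then show "w \<odot> z \<in> W'"
    proof (induction rule: span_induct)
      case base
      show "subspace {w. w \<odot> z \<in> W'}"
        using linear_map_subspace_vimage[OF mul_lin(2) sub', of z]
        by (simp add: vimage_def)
    next
      case (step g)
      then consider "g \<in> T" | x w where "g = x \<odot> w" "w \<in> W" | x w where "g = br x w" "w \<in> W"
        by (auto simp: G_def)
      then show ?case
      proof cases
        case 1
        then show ?thesis using \<open>left_invariant ?R T\<close> T' by (auto simp: left_invariant_def)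
      next
        case 2
        then show ?thesis using into(1)[of w "x \<odot> z"] right_commutative[of x w z] by simp
      next
        case 3
        then show ?thesis using W(8) T' by auto
      qed
    qed
  qed
  have st': "left_invariant mul W'" "left_invariant br W'" using into W'W by (auto simp: left_invariant_def)
  have "R_ad_trivial W' T"
    by (rule R_ad_trivial_between[OF step.prems(1)]) (use sub' W T' W'W st' in auto)
  then have "descends scale {mul, br, ?R} W' T"
    by (rule step.IH) (use W'C' stR step.prems in auto)
  \<comment> \<open>The commutation hypotheses are void, since \<open>ad\<close> maps \<open>W\<close> into \<open>W'\<close>.\<close>
  moreover have "descends scale {mul, br, ?R} W W'"
  proof (rule refine_by_nilpotent_family[where a = ?R and b = br and V = UNIV, OF mul_lin(2) br_lin(1) nil])
    show "\<exists>p q. br x (w \<odot> y) - (br x w \<odot> y + w \<odot> p + br q w) \<in> W'" if "w \<in> W" for w x y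
    proof -
      have "w \<odot> y \<in> W" using step.prems(3) that by (auto simp: left_invariant_def)
      then have "br x (w \<odot> y) - br x w \<odot> y \<in> W'"
        using into(2) W(8)[OF that] T' by (intro subspace_diff[OF sub']) auto
      then show ?thesis by (intro exI[of _ 0]) (simp add: mul_zero br_zero)
    qed
    show "\<exists>p\<in>UNIV. br x (w \<odot> v) - (br x w \<odot> v + w \<odot> p) \<in> W'" if "w \<in> W" for w x v
    proof -
      have "w \<odot> v \<in> W" using step.prems(3) that by (auto simp: left_invariant_def)
      then have "br x (w \<odot> v) - br x w \<odot> v \<in> W'"
        using into(2) W(8)[OF that] T' by (intro subspace_diff[OF sub']) auto
      then show ?thesis by (intro bexI[of _ 0]) (simp_all add: mul_zero)
    qed
    show "descends scale {mul, br, ?R} X X'"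
      if "subspace X" "subspace X'" "W' \<subseteq> X'" "X' \<subseteq> X" "X \<subseteq> W"
        "\<And>v w. v \<in> UNIV \<Longrightarrow> w \<in> X \<Longrightarrow> w \<odot> v \<in> X'" for X X'
    proof (rule r_into_rtranclp)
      have "x \<odot> w \<in> X'" "br x w \<in> X'" if "w \<in> X" for x w
        using into[of w x] \<open>W' \<subseteq> X'\<close> \<open>X \<subseteq> W\<close> that by blast+
      then show "descent_step scale {mul, br, ?R} X X'"
        using that(1,2,4,6) by (simp add: descent_step_def)
    qed
  qed (use sub' W W'W st' stR step.prems in auto)
  ultimately show ?case by simp
qed

section \<open>Powers of the ideal\<close>

lemma op_vector_space: "vector_space (op_scale scale :: 'k \<Rightarrow> ('a \<Rightarrow> 'a) \<Rightarrow> 'a \<Rightarrow> 'a)"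
  by unfold_locales
    (auto simp: op_scale_def fun_eq_iff scale_right_distrib scale_left_distrib)

sublocale op: vector_space "op_scale scale :: 'k \<Rightarrow> ('a \<Rightarrow> 'a) \<Rightarrow> 'a \<Rightarrow> 'a"
  by (rule op_vector_space)

abbreviation "MA \<equiv> mult_algebra scale mul br"
abbreviation "IR \<equiv> I_Rad scale mul br"

lemma op_subalgebra_MA: "op_subalgebra scale MA"
  unfolding mult_algebra_def
  by (rule hull_in) (auto simp: op_subalgebra_def intro!: op.subspace_Inter)

lemma generators_in_MA: "(\<odot>) x \<in> MA" "(\<lambda>a. a \<odot> x) \<in> MA" "br x \<in> MA"
proof -
  have "range (L_op mul) \<union> range (R_op mul) \<union> range (ad_op br) \<subseteq> MA"
    unfolding mult_algebra_def by (rule hull_subset)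
  then have "L_op mul x \<in> MA" "R_op mul x \<in> MA" "ad_op br x \<in> MA" by auto
  then show "(\<odot>) x \<in> MA" "(\<lambda>a. a \<odot> x) \<in> MA" "br x \<in> MA"
    by (simp_all add: L_op_def R_op_def ad_op_def)
qed

text \<open>
  The hull of a predicate is the intersection of all sets satisfying it, and would be the whole type if
  there were none; the algebra itself is an ideal containing the generators.
\<close>

lemma IR_subset_MA: "IR \<subseteq> MA"
  unfolding I_Rad_def
proof (rule hull_minimal)
  show "{R_op mul x \<circ> ad_op br y | x y. True} \<subseteq> MA"
    using generators_in_MA op_subalgebra_MA
    by (auto simp: op_subalgebra_def R_op_def ad_op_def)
  show "op_ideal scale MA MA"
    using op_subalgebra_MA by (auto simp: op_ideal_def op_subalgebra_def)
qed

lemma op_ideal_IR: "op_ideal scale MA IR"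
proof -
  have "op.subspace IR" "\<forall>m\<in>MA. \<forall>f\<in>IR. m \<circ> f \<in> IR \<and> f \<circ> m \<in> IR"
    unfolding I_Rad_def hull_def by (auto simp: op_ideal_def intro!: op.subspace_Inter)
  then show ?thesis using IR_subset_MA by (simp add: op_ideal_def)
qed

lemma R_ad_in_IR: "(\<lambda>a. br y a \<odot> x) \<in> IR"
proof -
  have "R_op mul x \<circ> ad_op br y \<in> IR"
    unfolding I_Rad_def by (rule hull_inc) blast
  then show ?thesis by (simp add: R_op_def ad_op_def comp_def)
qed

lemma subspace_op_power: "op.subspace (op_power scale IR n)"
  using op_ideal_IR by (cases n) (auto simp: op_ideal_def)

text \<open>
  Composition is additive in its left argument for arbitrary functions, in its right argument only if
  \<open>m\<close> is linear.
\<close>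

lemma op_power_absorbs:
  assumes "m \<in> MA" "Vector_Spaces.linear scale scale m" "f \<in> op_power scale IR n"
  shows "m \<circ> f \<in> op_power scale IR n"
proof (cases n)
  case 0
  then show ?thesis using assms op_ideal_IR by (auto simp: op_ideal_def)
next
  case (Suc k)
  have "f \<in> op.span {f \<circ> g | f g. f \<in> IR \<and> g \<in> op_power scale IR k}"
    using assms(3) Suc by simp
  then have "m \<circ> f \<in> op_power scale IR (Suc k)"
  proof (induction rule: op.span_induct)
    case base
    show "op.subspace {f. m \<circ> f \<in> op_power scale IR (Suc k)}"
    proof (rule op.subspaceI)
      fix f g :: "'a \<Rightarrow> 'a" and c
      have "m \<circ> 0 = 0" using linear_map_0[OF assms(2)] by (auto simp: fun_eq_iff)
      then show "0 \<in> {f. m \<circ> f \<in> op_power scale IR (Suc k)}"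
        using op.subspace_0[OF subspace_op_power] by (metis mem_Collect_eq)
      have "m \<circ> (f + g) = (m \<circ> f) + (m \<circ> g)"
        using linear_map_add[OF assms(2)] by (auto simp: fun_eq_iff)
      then show "f + g \<in> {f. m \<circ> f \<in> op_power scale IR (Suc k)}"
        if "f \<in> {f. m \<circ> f \<in> op_power scale IR (Suc k)}" "g \<in> {f. m \<circ> f \<in> op_power scale IR (Suc k)}"
        using op.subspace_add[OF subspace_op_power] that by (metis mem_Collect_eq)
      have "m \<circ> op_scale scale c f = op_scale scale c (m \<circ> f)"
        using linear_map_scale[OF assms(2)] by (auto simp: fun_eq_iff op_scale_def)
      then show "op_scale scale c f \<in> {f. m \<circ> f \<in> op_power scale IR (Suc k)}"
        if "f \<in> {f. m \<circ> f \<in> op_power scale IR (Suc k)}"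
        using op.subspace_scale[OF subspace_op_power] that by (metis mem_Collect_eq)
    qed
  next
    case (step h)
    then obtain f g where h: "h = f \<circ> g" "f \<in> IR" "g \<in> op_power scale IR k" by blast
    have "m \<circ> f \<in> IR" using assms(1) h(2) op_ideal_IR by (auto simp: op_ideal_def)
    then have "(m \<circ> f) \<circ> g \<in> op_power scale IR (Suc k)"
      unfolding op_power.simps by (intro op.span_base) (use h(3) in blast)
    then show ?case unfolding h(1) mem_Collect_eq comp_assoc .
  qed
  then show ?thesis by (simp add: Suc)
qed

text \<open>
  The subspace \<open>I\<^sup>i A\<close>.  The index shift is the one of \<open>op_power\<close>, whose value at \<open>n\<close> is \<open>I\<^sup>n\<^sup>+\<^sup>1\<close>.
\<close>

fun power_image :: "nat \<Rightarrow> 'a set" where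
  "power_image 0 = UNIV"
| "power_image (Suc n) = span {f a | f a. f \<in> op_power scale IR n}"

lemma subspace_power_image: "subspace (power_image i)"
  by (cases i) (auto simp: subspace_UNIV)

lemma power_image_absorbs:
  assumes "m \<in> MA" "Vector_Spaces.linear scale scale m" "v \<in> power_image i"
  shows "m v \<in> power_image i"
proof (cases i)
  case (Suc n)
  have "v \<in> span {f a | f a. f \<in> op_power scale IR n}" using assms(3) Suc by simp
  then have "m v \<in> power_image (Suc n)"
  proof (induction rule: span_induct)
    case base
    show ?case
      using linear_map_subspace_vimage[OF assms(2) subspace_power_image[of "Suc n"]]
      by (simp add: vimage_def)
  next
    case (step u)
    then obtain f a where u: "u = f a" "f \<in> op_power scale IR n" by blast
    then have "m u = (m \<circ> f) a" "m \<circ> f \<in> op_power scale IR n"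
      using op_power_absorbs[OF assms(1,2)] by auto
    then show ?case unfolding power_image.simps by (intro span_base) blast
  qed
  then show ?thesis by (simp add: Suc)
qed simp

lemma power_image_R_ad:
  assumes "v \<in> power_image i"
  shows "br y v \<odot> x \<in> power_image (Suc i)"
proof (cases i)
  case 0
  show ?thesis unfolding power_image.simps 0 op_power.simps
    by (rule span_base) (use R_ad_in_IR[of y x] in \<open>auto\<close>)
next
  case (Suc n)
  have lin: "Vector_Spaces.linear scale scale (\<lambda>a. br y a \<odot> x)"
    using Vector_Spaces.linear_compose[OF br_lin(1)[of y] mul_lin(2)[of x]] by (simp add: comp_def)
  have "v \<in> span {f a | f a. f \<in> op_power scale IR n}" using assms Suc by simp
  then have "br y v \<odot> x \<in> power_image (Suc (Suc n))"
  proof (induction rule: span_induct)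
    case base
    show ?case
      using linear_map_subspace_vimage[OF lin subspace_power_image[of "Suc (Suc n)"]]
      by (simp add: vimage_def)
  next
    case (step u)
    then obtain f a where u: "u = f a" "f \<in> op_power scale IR n" by blast
    then have "br y u \<odot> x = ((\<lambda>a. br y a \<odot> x) \<circ> f) a"
      "(\<lambda>a. br y a \<odot> x) \<circ> f \<in> op_power scale IR (Suc n)"
      using R_ad_in_IR by (auto intro!: op.span_base)
    then show ?case unfolding power_image.simps(2)[of "Suc n"] by (intro span_base) blast
  qed
  then show ?thesis by (simp add: Suc)
qed

lemma op_power_decreasing: "op_power scale IR (Suc n) \<subseteq> op_power scale IR n"
proof (induction n)
  case 0
  have "{f \<circ> g | f g. f \<in> IR \<and> g \<in> IR} \<subseteq> IR" "op.subspace IR"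
    using op_ideal_IR by (auto simp: op_ideal_def)
  then show ?case by (simp add: op.span_minimal)
next
  case (Suc n)
  then have "{f \<circ> g | f g. f \<in> IR \<and> g \<in> op_power scale IR (Suc n)}
      \<subseteq> {f \<circ> g | f g. f \<in> IR \<and> g \<in> op_power scale IR n}"
    by blast
  from op.span_mono[OF this] show ?case
    unfolding op_power.simps(2)[of scale IR "Suc n"] unfolding op_power.simps(2)[of scale IR n] .
qed

lemma power_image_decreasing: "power_image (Suc i) \<subseteq> power_image i"
proof (cases i)
  case (Suc n)
  show ?thesis
    unfolding Suc power_image.simps by (rule span_mono) (use op_power_decreasing in blast)
qed simp

section \<open>Nilpotency from the three conditions\<close>

text \<open>
  The images \<open>I\<^sup>i A\<close> enter twice: once as the modules whose factors are treated separately, and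
  inside each factor as the index sets in \<open>L_ad_descent\<close>.
\<close>

lemma gd_nilpotentI:
  assumes "lie_nilpotent scale br" "novikov_nilpotent scale mul" "op_nilpotent scale IR"
  shows "gd_nilpotent scale mul br"
proof -
  obtain M where nil_ad: "lie_lower_central scale br M = {0}"
    using assms(1) by (auto simp: lie_nilpotent_def)
  obtain N where N: "N \<ge> 1" "lower_central scale {mul} N = {0}"
    using assms(2) by (auto simp: novikov_nilpotent_def)
  have N': "Suc (N - 1) = N" using N(1) by simp
  have nil_L: "lie_lower_central scale mul (N - 1) = {0}"
    using lie_lower_central_subset[of mul "{mul}" "N - 1"] N subspace_0[OF subspace_lie_lower_central]
    unfolding N' by blast
  let ?R = "\<lambda>x y. y \<odot> x"
  have nil_R: "lie_lower_central scale ?R (N - 1) = {0}"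
    using lie_lower_central_flip_subset[of mul "{mul}" "N - 1"] N subspace_0[OF subspace_lie_lower_central]
    unfolding N' by blast
  obtain n where n: "op_power scale IR n = {0}"
    using assms(3) by (auto simp: op_nilpotent_def)
  have last: "power_image (Suc n) = {0}"
    by (auto simp: n)
  have A_mul: "y \<odot> v \<in> power_image i" and A_br: "br y v \<in> power_image i"
    and A_R: "v \<odot> y \<in> power_image i" if "v \<in> power_image i" for i y v
    using power_image_absorbs generators_in_MA mul_lin br_lin that by blast+
  have factor: "descends scale {mul, br, ?R} (power_image i) (power_image (Suc i))" for i
  proof (rule full_descent_of_L_ad_descent[OF nil_R _ _ order_refl])
    show triv: "R_ad_trivial (power_image i) (power_image (Suc i))"
      unfolding R_ad_trivial_def left_invariant_def
      using subspace_power_image power_image_decreasing A_mul A_br power_image_R_ad by blast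
    show "descends scale {mul, br} (power_image i) (power_image (Suc i))"
    proof (rule L_ad_descent[OF nil_L nil_ad, of power_image, OF _ A_mul A_br power_image_R_ad triv])
      fix v w assume "v \<in> power_image (Suc n)"
      then have "v = 0" using last by blast
      then show "br v w \<in> power_image (Suc i)"
        using br_zero subspace_0[OF subspace_power_image] by metis
    qed (simp_all only: power_image.simps)
  qed (use A_R in \<open>auto simp only: left_invariant_def\<close>)
  have "descends scale {mul, br, ?R} UNIV (power_image i)" for i
  proof (induction i)
    case (Suc i)
    then show ?case using factor[of i] by (rule rtranclp_trans)
  qed simp
  from this[of "Suc n"] have "descends scale {mul, br, ?R} UNIV {0}" by (simp only: last)
  then have "\<exists>k\<ge>1. \<forall>m\<ge>k. lower_central scale {mul, br} m \<subseteq> {0}"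
  proof (rule lower_central_below_descent)
    fix W W' p x w
    assume *: "descent_step scale {mul, br, ?R} W W'" "p \<in> {mul, br}" "w \<in> W"
    then have "x \<odot> w \<in> W'" "w \<odot> x \<in> W'" "br x w \<in> W'" "- br x w \<in> W'"
      by (auto simp: descent_step_def intro!: subspace_neg)
    then show "p x w \<in> W' \<and> p w x \<in> W'" using *(2) br_anticommute[of w x] by auto
  qed
  then obtain k where "k \<ge> 1" "\<And>m. m \<ge> k \<Longrightarrow> lower_central scale {mul, br} m \<subseteq> {0}"
    by blast
  then show ?thesis
    unfolding gd_nilpotent_def using subspace_0[OF subspace_lower_central] by blast
qed

section \<open>Operators on the lower central series\<close>

text \<open>The restriction to \<open>k \<ge> 1\<close> leaves out the dummy term at index 0.\<close>

definition raises_central_degree :: "nat \<Rightarrow> ('a \<Rightarrow> 'a) \<Rightarrow> bool"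
  where "raises_central_degree d f \<longleftrightarrow>
    (\<forall>k\<ge>1. f ` lower_central scale {mul, br} k \<subseteq> lower_central scale {mul, br} (k + d))"

lemma subspace_raises_central_degree: "op.subspace {f. raises_central_degree d f}"
  by (rule op.subspaceI)
    (auto simp: raises_central_degree_def image_subset_iff op_scale_def
      intro: subspace_0 subspace_add subspace_scale subspace_lower_central)

lemma raises_central_degree_comp:
  assumes "raises_central_degree d f" "raises_central_degree e g"
  shows "raises_central_degree (d + e) (f \<circ> g)"
  unfolding raises_central_degree_def image_subset_iff
proof (intro allI impI ballI)
  fix k a assume k: "k \<ge> 1" and "a \<in> lower_central scale {mul, br} k"
  then have "g a \<in> lower_central scale {mul, br} (k + e)"
    using assms(2) by (auto simp: raises_central_degree_def)
  then have "f (g a) \<in> lower_central scale {mul, br} (k + e + d)"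
    using assms(1)[unfolded raises_central_degree_def, rule_format, of "k + e"] k
    by (simp add: image_subset_iff)
  then show "(f \<circ> g) a \<in> lower_central scale {mul, br} (k + (d + e))" by (simp add: ac_simps)
qed

lemma MA_raises_central_degree: "MA \<subseteq> {f. raises_central_degree 1 f}"
  unfolding mult_algebra_def
proof (rule hull_minimal)
  let ?P = "{mul, br}"
  have "x \<odot> a \<in> lower_central scale ?P (Suc k)" "a \<odot> x \<in> lower_central scale ?P (Suc k)"
    "br x a \<in> lower_central scale ?P (Suc k)"
    if "k \<ge> 1" "a \<in> lower_central scale ?P k" for x a k
    using lower_central_product[of _ ?P x 1 a k] lower_central_product[of _ ?P a k x 1] that
    by auto
  then show "range (L_op mul) \<union> range (R_op mul) \<union> range (ad_op br)
      \<subseteq> {f. raises_central_degree 1 f}"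
    by (auto simp: raises_central_degree_def L_op_def R_op_def ad_op_def)
  have "raises_central_degree 1 (f \<circ> g)" if "raises_central_degree 1 f" "raises_central_degree 1 g" for f g
    using raises_central_degree_comp[OF that] lower_central_decreasing
    unfolding raises_central_degree_def by fastforce
  then show "op_subalgebra scale {f. raises_central_degree 1 f}"
    using subspace_raises_central_degree by (simp add: op_subalgebra_def)
qed

lemma op_power_raises_central_degree:
  "op_power scale IR n \<subseteq> {f. raises_central_degree (Suc n) f}"
proof (induction n)
  case 0
  then show ?case using IR_subset_MA MA_raises_central_degree by auto
next
  case (Suc n)
  have "{f \<circ> g | f g. f \<in> IR \<and> g \<in> op_power scale IR n} \<subseteq> {f. raises_central_degree (Suc (Suc n)) f}"
    using Suc IR_subset_MA MA_raises_central_degree raises_central_degree_comp[of 1 _ "Suc n"] by fastforce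
  then show ?case
    unfolding op_power.simps by (rule op.span_minimal[OF _ subspace_raises_central_degree])
qed

lemma gd_nilpotentD:
  assumes "gd_nilpotent scale mul br"
  shows "lie_nilpotent scale br" "novikov_nilpotent scale mul" "op_nilpotent scale IR"
proof -
  obtain N where N: "N \<ge> 1" "lower_central scale {mul, br} N = {0}"
    using assms by (auto simp: gd_nilpotent_def)
  have zero: "lower_central scale {mul, br} n \<subseteq> {0}" if "n \<ge> N" for n
    using lower_central_antimono[OF that] N(2) by blast
  have "lie_lower_central scale br N = {0}"
    using lie_lower_central_subset[of br "{mul, br}" N] zero[of "Suc N"]
      subspace_0[OF subspace_lie_lower_central[of br N]] by auto
  then show "lie_nilpotent scale br" by (auto simp: lie_nilpotent_def)
  have "lower_central scale {mul} N = {0}"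
    using lower_central_mono[of "{mul}" "{mul, br}" N] N(2) subspace_0[OF subspace_lower_central]
    by blast
  then show "novikov_nilpotent scale mul" using N(1) by (auto simp: novikov_nilpotent_def)
  have "f = 0" if "f \<in> op_power scale IR N" for f
  proof
    fix a
    have "f a \<in> lower_central scale {mul, br} (1 + Suc N)"
      using that op_power_raises_central_degree[of N] by (force simp: raises_central_degree_def)
    then show "f a = 0 a" using zero[of "1 + Suc N"] by auto
  qed
  then have "op_power scale IR N = {0}"
    using op.subspace_0[OF subspace_op_power] by blast
  then show "op_nilpotent scale IR" by (auto simp: op_nilpotent_def)
qed

end

theorem theorem3p4:
  fixes scale :: "'k::{alg_closed_field, field_char_0} \<Rightarrow> 'a::ab_group_add \<Rightarrow> 'a"
    and mul br :: "'a \<Rightarrow> 'a \<Rightarrow> 'a"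
  assumes "gd_algebra scale mul br"
    and "finite_dimensional scale"
  shows "gd_nilpotent scale mul br \<longleftrightarrow>
    lie_nilpotent scale br \<and>
    novikov_nilpotent scale mul \<and>
    op_nilpotent scale (I_Rad scale mul br)"
  using gd_algebra.gd_nilpotentI[OF assms(1)] gd_algebra.gd_nilpotentD[OF assms(1)]
  by blast

end
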